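(* Let $\Omega$ be a finite set and let $G\le\operatorname{Sym}(\Omega)$ be a transitive permutation group whose point stabilizers have order $2$ and which admits a subgroup $R\le G$ acting regularly on $\Omega$. Then the orbital scheme $\mathfrak{X}$ of $G$ is triply transitive.
   Context: An association scheme $\mathfrak{X}=(\Omega,\mathcal{R})$ consists of a finite set $\Omega$ and a set $\mathcal{R}=\{R_0,\ldots,R_d\}$ of (nonempty) relations on $\Omega$ with $R_0=\{(\omega,\omega):\omega\in\Omega\}$ such that: $\mathcal{R}$ is a partition of $\Omega\times\Omega$; for every $i$ the relation $R_i^*=\{(v,u):(u,v)\in R_i\}$ is in $\mathcal{R}$; and for all $0\le i,j,k\le d$ there is an integer $p_{ij}^k\ge 0$ such that $|\{w\in\Omega:(u,w)\in R_i,\ (w,v)\in R_j\}|=p_{ij}^k$ for every $(u,v)\in R_k$. (Commutativity is not assumed.) The orbital scheme of a transitive group $G\le\operatorname{Sym}(\Omega)$ is the association scheme whose relations are the orbitals of $G$, i.e. the orbits of $G$ on $\Omega\times\Omega$. $\operatorname{Aut}(\mathfrak{X})$ is the group of permutations of $\Omega$ preserving every $R_i$. Fix $v\in\Omega$ and let $\operatorname{Aut}(\mathfrak{X})_v$ be the stabilizer of $v$ in $\operatorname{Aut}(\mathfrak{X})$. Let $A_i$ be the $0/1$ adjacency matrix of $R_i$ and let $E_i^*$ be the diagonal matrix with $E_i^*(u,u)=1$ if $(v,u)\in R_i$ and $0$ otherwise. Inside the matrix algebra $\operatorname{M}_\Omega(\mathbb{C})$ put: $T_0=\operatorname{Span}\{E_i^*A_jE_k^*:0\le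 i,j,k\le d\}$; $T$ the algebra generated by $A_0,\ldots,A_d,E_0^*,\ldots,E_d^*$ (the Terwilliger algebra); and $\tilde T$ the algebra of all matrices commuting with all permutation matrices of elements of $\operatorname{Aut}(\mathfrak{X})_v$. One has $T_0\subseteq T\subseteq\tilde T$, and when $\operatorname{Aut}(\mathfrak{X})$ is transitive these depend on $v$ only up to isomorphism. The scheme $\mathfrak{X}$ is triply transitive if $\operatorname{Aut}(\mathfrak{X})$ is transitive on $\Omega$ and $T_0=T=\tilde T$. *)

theory Defs
  imports "HOL-Analysis.Analysis" "HOL-Algebra.Group_Action"
begin

text \<open>
  The finite set \<open>\<Omega>\<close> is the universe of a type \<open>'v :: finite\<close>, and \<open>Sym(\<Omega>)\<close> is
  \<^term>\<open>BijGroup UNIV\<close>. Since the type is nonempty, so is \<open>\<Omega>\<close>.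
\<close>

section \<open>Permutation groups\<close>

definition perm_group :: "('v \<Rightarrow> 'v) set \<Rightarrow> ('v \<Rightarrow> 'v) monoid" where
  "perm_group G = (BijGroup UNIV) \<lparr>carrier := G\<rparr>"

definition transitive_perm_group :: "('v \<Rightarrow> 'v) set \<Rightarrow> bool" where
  "transitive_perm_group G \<longleftrightarrow>
     subgroup G (BijGroup UNIV) \<and> transitive_action (perm_group G) UNIV (\<lambda>g. g)"

definition point_stabilizer :: "('v \<Rightarrow> 'v) set \<Rightarrow> 'v \<Rightarrow> ('v \<Rightarrow> 'v) set" where
  "point_stabilizer G v = stabilizer (perm_group G) (\<lambda>g. g) v"

definition regular_perm_group :: "('v \<Rightarrow> 'v) set \<Rightarrow> bool" where
  "regular_perm_group G \<longleftrightarrow>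
     transitive_perm_group G \<and> (\<forall>v. point_stabilizer G v = {\<one>\<^bsub>perm_group G\<^esub>})"

definition orbitals :: "('v \<Rightarrow> 'v) set \<Rightarrow> 'v rel set" where
  "orbitals G = orbits (perm_group G) UNIV (\<lambda>g. map_prod g g)"


section \<open>Association schemes\<close>

definition association_scheme :: "'v::finite rel set \<Rightarrow> bool" where
  "association_scheme \<R> \<longleftrightarrow>
     partition_on UNIV \<R> \<and>
     Id \<in> \<R> \<and>
     (\<forall>R\<in>\<R>. R\<inverse> \<in> \<R>) \<and>
     (\<forall>R\<in>\<R>. \<forall>S\<in>\<R>. \<forall>T\<in>\<R>. \<exists>p::nat. \<forall>(u, v)\<in>T.
        card {w. (u, w) \<in> R \<and> (w, v) \<in> S} = p)"

definition scheme_Aut :: "'v rel set \<Rightarrow> ('v \<Rightarrow> 'v) set" where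
  "scheme_Aut \<R> =
     {g \<in> carrier (BijGroup UNIV). \<forall>R\<in>\<R>. map_prod g g ` R = R}"


section \<open>Complex matrices indexed by the points\<close>

type_synonym 'v cmat = "complex ^ 'v ^ 'v"

text \<open>
  The scalar multiplication \<open>(*\<^sub>R)\<close> on this type is only real, so complex spans need the
  complex scaling below.
\<close>

definition cmat_scale :: "complex \<Rightarrow> 'v::finite cmat \<Rightarrow> 'v cmat" where
  "cmat_scale c M = (\<chi> u w. c * M $ u $ w)"

interpretation cmat: vector_space cmat_scale
  by unfold_locales (simp_all add: cmat_scale_def vec_eq_iff algebra_simps)

definition subalgebra :: "'v::finite cmat set \<Rightarrow> bool" where
  "subalgebra S \<longleftrightarrow>
     cmat.subspace S \<and> mat 1 \<in> S \<and> (\<forall>M\<in>S. \<forall>N\<in>S. M ** N \<in> S)"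

definition perm_mat :: "('v \<Rightarrow> 'v) \<Rightarrow> 'v::finite cmat" where
  "perm_mat g = (\<chi> u w. if u = g w then 1 else 0)"

definition adjacency :: "'v rel \<Rightarrow> 'v::finite cmat" where
  "adjacency R = (\<chi> u w. if (u, w) \<in> R then 1 else 0)"

definition dual_idempotent :: "'v \<Rightarrow> 'v rel \<Rightarrow> 'v::finite cmat" where
  "dual_idempotent v R = (\<chi> u w. if u = w \<and> (v, u) \<in> R then 1 else 0)"

definition T0_space :: "'v rel set \<Rightarrow> 'v \<Rightarrow> 'v::finite cmat set" where
  "T0_space \<R> v =
     cmat.span {dual_idempotent v R ** adjacency S ** dual_idempotent v T |
                R S T. R \<in> \<R> \<and> S \<in> \<R> \<and> T \<in> \<R>}"

definition terwilliger_algebra :: "'v rel set \<Rightarrow> 'v \<Rightarrow> 'v::finite cmat set" where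
  "terwilliger_algebra \<R> v =
     subalgebra hull (adjacency ` \<R> \<union> dual_idempotent v ` \<R>)"

definition centralizer_algebra :: "'v rel set \<Rightarrow> 'v \<Rightarrow> 'v::finite cmat set" where
  "centralizer_algebra \<R> v =
     {M. \<forall>g\<in>point_stabilizer (scheme_Aut \<R>) v. perm_mat g ** M = M ** perm_mat g}"

text \<open>
  The base point is quantified universally: when the automorphism group is transitive, the
  three spaces depend on it only up to conjugation by a permutation matrix.
\<close>

definition triply_transitive :: "'v::finite rel set \<Rightarrow> bool" where
  "triply_transitive \<R> \<longleftrightarrow>
     transitive_perm_group (scheme_Aut \<R>) \<and>
     (\<forall>v. T0_space \<R> v = terwilliger_algebra \<R> v \<and>
          terwilliger_algebra \<R> v = centralizer_algebra \<R> v)"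

end

theory Submission
  imports Defs
begin

text \<open>
  For every \<open>v\<close> one has \<open>T\<^sub>0 \<subseteq> T \<subseteq> T' \<subseteq> C(G\<^sub>v)\<close>, where \<open>T'\<close> and
  \<open>C(G\<^sub>v)\<close> are the centralizers of \<open>Aut(\<XX>)\<^sub>v\<close> and of its subgroup \<open>G\<^sub>v\<close>. So it suffices that \<open>C(G\<^sub>v) \<subseteq> T\<^sub>0\<close>,
  that is, that two pairs \<open>(x, y)\<close>, \<open>(x', y')\<close> lie in one orbit of \<open>G\<^sub>v\<close> as soon as the pairs
  \<open>(v, x)\<close>, \<open>(v, x')\<close>, the pairs \<open>(v, y)\<close>, \<open>(v, y')\<close> and the pairs \<open>(x, y)\<close>, \<open>(x', y')\<close> lie in
  the same orbitals of \<open>G\<close>.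

  If \<open>G\<^sub>v = {1, t}\<close>, then up to applying \<open>t\<close> the only case to consider is \<open>x' = x\<close> and
  \<open>y' = t y \<noteq> y\<close>. Then the nontrivial element \<open>s\<close> of \<open>G\<^sub>x\<close> satisfies
  \<open>s y = t y\<close>. As \<open>R\<close> has index 2 in \<open>G\<close> and meets the point stabilizers trivially,
  \<open>t = r s\<close> with \<open>r \<in> R\<close>, and \<open>r\<close> fixes \<open>s y\<close>. Hence \<open>r = 1\<close> and \<open>t = s\<close>
  fixes \<open>x\<close>, so \<open>t\<close> itself maps \<open>(x, y)\<close> to \<open>(x', y')\<close>.
\<close>

section \<open>Permutation groups and their orbitals\<close>

text \<open>Over \<open>UNIV\<close> the extensionality built into \<open>BijGroup\<close> is
  vacuous, so its elements are plain bijections.\<close>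

lemma carrier_BijGroup_UNIV: "carrier (BijGroup UNIV) = {g. bij g}"
  by (simp add: BijGroup_def Bij_def extensional_def)

lemma mult_BijGroup_UNIV: "bij g \<Longrightarrow> bij h \<Longrightarrow> g \<otimes>\<^bsub>BijGroup UNIV\<^esub> h = g \<circ> h"
  by (auto simp: BijGroup_def Bij_def extensional_def compose_def)

lemma one_BijGroup_UNIV: "\<one>\<^bsub>BijGroup UNIV\<^esub> = id"
  by (auto simp: BijGroup_def)

lemma inv_BijGroup_UNIV: "bij g \<Longrightarrow> inv\<^bsub>BijGroup UNIV\<^esub> g = Hilbert_Choice.inv g"
  by (subst inv_BijGroup) (auto simp: Bij_def extensional_def)

lemma subgroup_BijGroup_iff:
  "subgroup G (BijGroup UNIV) \<longleftrightarrow>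
     (\<forall>g\<in>G. bij g) \<and> id \<in> G \<and> (\<forall>g\<in>G. \<forall>h\<in>G. g \<circ> h \<in> G) \<and> (\<forall>g\<in>G. Hilbert_Choice.inv g \<in> G)"
  unfolding subgroup_def carrier_BijGroup_UNIV one_BijGroup_UNIV
  by (auto simp: mult_BijGroup_UNIV inv_BijGroup_UNIV subset_iff)

lemma transitive_perm_group_iff:
  "transitive_perm_group G \<longleftrightarrow> subgroup G (BijGroup UNIV) \<and> (\<forall>x y. \<exists>g\<in>G. g x = y)"
proof -
  \<comment> \<open>The inclusion of a subgroup is a homomorphism, so of
    \<open>transitive_action\<close> only the existence of \<open>g\<close> remains.\<close>
  have "group_action (perm_group G) UNIV (\<lambda>g. g)" if "subgroup G (BijGroup UNIV)"
    using group.canonical_inj_is_hom[OF group_BijGroup that]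
    by (simp add: group_action_def perm_group_def id_def)
  then show ?thesis
    by (auto simp: transitive_perm_group_def transitive_action_def transitive_action_axioms_def
        perm_group_def)
qed

lemma point_stabilizer_eq: "point_stabilizer G v = {g \<in> G. g v = v}"
  by (simp add: point_stabilizer_def stabilizer_def perm_group_def)

lemma orbitals_eq: "orbitals G = range (\<lambda>(x, y). {(g x, g y) | g. g \<in> G})"
  by (auto simp: orbitals_def orbits_def orbit_def perm_group_def)

locale permutation_group =
  fixes G :: "('v \<Rightarrow> 'v) set"
  assumes sub: "subgroup G (BijGroup UNIV)"
begin

lemma bij: "g \<in> G \<Longrightarrow> bij g"
  and id_mem: "id \<in> G"
  and comp_mem: "g \<in> G \<Longrightarrow> h \<in> G \<Longrightarrow> g \<circ> h \<in> G"
  and inv_mem: "g \<in> G \<Longrightarrow> Hilbert_Choice.inv g \<in> G"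
  using sub by (auto simp: subgroup_BijGroup_iff)

lemma inv_apply: "g \<in> G \<Longrightarrow> Hilbert_Choice.inv g (g x) = x"
  and apply_inv: "g \<in> G \<Longrightarrow> g (Hilbert_Choice.inv g x) = x"
  using bij by (simp_all add: bij_is_inj bij_is_surj surj_f_inv_f)

lemma apply_mem_orbital: "S \<in> orbitals G \<Longrightarrow> g \<in> G \<Longrightarrow> (x, y) \<in> S \<Longrightarrow> (g x, g y) \<in> S"
  unfolding orbitals_eq by clarsimp (metis comp_mem comp_apply)

text \<open>An orbital is the orbit of one pair \<open>(a, b)\<close>; if \<open>g\<close> and
  \<open>h\<close> carry that pair to the two given ones, then the inverse of \<open>g\<close>
  followed by \<open>h\<close> moves the first to the second.\<close>

lemma orbital_transitive:
  assumes "S \<in> orbitals G" "(x, y) \<in> S" "(x', y') \<in> S"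
  obtains g where "g \<in> G" "g x = x'" "g y = y'"
proof -
  obtain a b g h where "g \<in> G" "h \<in> G" "x = g a" "y = g b" "x' = h a" "y' = h b"
    using assms by (auto simp: orbitals_eq)
  then show thesis
    using that[of "h \<circ> Hilbert_Choice.inv g"] comp_mem inv_mem by (simp add: inv_apply)
qed

lemma orbital_exists: obtains S where "S \<in> orbitals G" "(x, y) \<in> S"
proof (rule that)
  show "{(g x, g y) | g. g \<in> G} \<in> orbitals G"
    unfolding orbitals_eq by (intro image_eqI[where x = "(x, y)"]) auto
  show "(x, y) \<in> {(g x, g y) | g. g \<in> G}"
    using id_mem by (auto intro!: exI[of _ id])
qed

lemma orbital_unique:
  assumes "S \<in> orbitals G" "T \<in> orbitals G" "(x, y) \<in> S" "(x, y) \<in> T"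
  shows "S = T"
proof -
  have "S' \<subseteq> T'" if S': "S' \<in> orbitals G" "(x, y) \<in> S'"
    and T': "T' \<in> orbitals G" "(x, y) \<in> T'" for S' T'
  proof (rule subrelI)
    fix a b
    assume "(a, b) \<in> S'"
    then obtain g where "g \<in> G" "g x = a" "g y = b"
      by (rule orbital_transitive[OF S'])
    then show "(a, b) \<in> T'"
      using apply_mem_orbital[OF T'(1) _ T'(2)] by metis
  qed
  then show ?thesis
    using assms by blast
qed

lemma partition_on_orbitals: "partition_on UNIV (orbitals G)"
proof (rule partition_onI)
  show "\<Union>(orbitals G) = UNIV"
    using orbital_exists by (metis UNIV_eq_I UnionI surj_pair)
  show "disjnt S T" if "S \<in> orbitals G" "T \<in> orbitals G" "S \<noteq> T" for S T
    using that orbital_unique[OF that(1,2)] by (auto simp: disjnt_def)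
  show "{} \<notin> orbitals G"
    using id_mem by (auto simp: orbitals_eq)
qed

lemma converse_orbital: "S \<in> orbitals G \<Longrightarrow> S\<inverse> \<in> orbitals G"
proof -
  assume "S \<in> orbitals G"
  then obtain x y where "S = {(g x, g y) | g. g \<in> G}"
    by (auto simp: orbitals_eq)
  then have "S\<inverse> = {(g y, g x) | g. g \<in> G}"
    by auto
  then show ?thesis
    unfolding orbitals_eq by (intro image_eqI[where x = "(y, x)"]) auto
qed

lemma map_prod_image_orbital:
  assumes "S \<in> orbitals G" "g \<in> G"
  shows "map_prod g g ` S = S"
proof
  show "map_prod g g ` S \<subseteq> S"
    using assms by (auto intro: apply_mem_orbital)
  show "S \<subseteq> map_prod g g ` S"
  proof (rule subrelI)
    fix x y assume "(x, y) \<in> S"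
    then have "(Hilbert_Choice.inv g x, Hilbert_Choice.inv g y) \<in> S"
      using assms inv_mem apply_mem_orbital by blast
    then show "(x, y) \<in> map_prod g g ` S"
      using assms by (force simp: apply_inv)
  qed
qed

lemma subset_scheme_Aut: "G \<subseteq> scheme_Aut (orbitals G)"
proof
  fix g
  assume "g \<in> G"
  then show "g \<in> scheme_Aut (orbitals G)"
    using bij map_prod_image_orbital by (simp add: scheme_Aut_def carrier_BijGroup_UNIV)
qed

end

lemma association_scheme_orbitals:
  fixes G :: "('v::finite \<Rightarrow> 'v) set"
  assumes "transitive_perm_group G"
  shows "association_scheme (orbitals G)"
proof -
  interpret permutation_group G
    using assms by (simp add: permutation_group_def transitive_perm_group_iff)
  have trans: "\<exists>g\<in>G. g x = y" for x y
    using assms by (simp add: transitive_perm_group_iff)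
  then have "\<exists>g. y = g x \<and> g \<in> G" for x y
    by metis
  then have "{(g x, g x) | g. g \<in> G} = Id" for x
    by auto
  \<comment> \<open>By transitivity every diagonal pair generates \<open>Id\<close>;
    \<open>undefined\<close> is an arbitrary point.\<close>
  then have "Id \<in> orbitals G"
    unfolding orbitals_eq by (intro image_eqI[where x = "(undefined, undefined)"]) auto
  moreover have "\<exists>p. \<forall>(u, v)\<in>U. card {w. (u, w) \<in> S \<and> (w, v) \<in> T} = p"
    if "S \<in> orbitals G" "T \<in> orbitals G" "U \<in> orbitals G" for S T U
  proof -
    \<comment> \<open>One inequality suffices, as the two pairs may be exchanged; an element of
      \<open>G\<close> moving one pair to the other injects the counted points.\<close>
    have le: "card {w. (u, w) \<in> S \<and> (w, v) \<in> T} \<le> card {w. (u', w) \<in> S \<and> (w, v') \<in> T}"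
      if uv: "(u, v) \<in> U" "(u', v') \<in> U" for u v u' v'
    proof -
      obtain g where g: "g \<in> G" "g u = u'" "g v = v'"
        using orbital_transitive[OF \<open>U \<in> orbitals G\<close> uv] .
      show ?thesis
      proof (rule card_inj_on_le[where f = g])
        show "inj_on g {w. (u, w) \<in> S \<and> (w, v) \<in> T}"
          using bij[OF g(1)] by (meson bij_is_inj inj_on_subset subset_UNIV)
        show "g ` {w. (u, w) \<in> S \<and> (w, v) \<in> T} \<subseteq> {w. (u', w) \<in> S \<and> (w, v') \<in> T}"
          using g that \<open>S \<in> orbitals G\<close> \<open>T \<in> orbitals G\<close> apply_mem_orbital by blast
      qed simp
    qed
    obtain u v where "(u, v) \<in> U"
      using partition_on_orbitals \<open>U \<in> orbitals G\<close> by (metis partition_on_def subrelI subset_empty)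
    then show ?thesis
      using le by (intro exI[of _ "card {w. (u, w) \<in> S \<and> (w, v) \<in> T}"]) (auto intro: le_antisym)
  qed
  ultimately show ?thesis
    using partition_on_orbitals converse_orbital by (auto simp: association_scheme_def)
qed

section \<open>Automorphisms of a scheme\<close>

lemma subgroup_scheme_Aut: "subgroup (scheme_Aut \<R>) (BijGroup UNIV)"
proof -
  have "map_prod (g \<circ> h) (g \<circ> h) ` S = map_prod g g ` map_prod h h ` S" for g h :: "'a \<Rightarrow> 'a" and S
    by (auto simp: image_comp map_prod_compose)
  moreover have "map_prod (Hilbert_Choice.inv g) (Hilbert_Choice.inv g) ` S = S"
    if "bij g" "map_prod g g ` S = S" for g :: "'a \<Rightarrow> 'a" and S
  proof -
    have "map_prod (Hilbert_Choice.inv g) (Hilbert_Choice.inv g) ` map_prod g g ` S = S"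
      using that(1) by (simp add: image_comp map_prod.comp bij_is_inj map_prod.id)
    then show ?thesis
      by (simp add: that(2))
  qed
  ultimately show ?thesis
    by (auto simp: subgroup_BijGroup_iff scheme_Aut_def carrier_BijGroup_UNIV bij_comp
        bij_imp_bij_inv map_prod.id)
qed

lemma scheme_Aut_mem_iff:
  assumes "g \<in> scheme_Aut \<R>" "S \<in> \<R>"
  shows "(g x, g y) \<in> S \<longleftrightarrow> (x, y) \<in> S"
proof -
  have "bij g" "map_prod g g ` S = S"
    using assms by (auto simp: scheme_Aut_def carrier_BijGroup_UNIV)
  then show ?thesis
    by (metis (no_types, lifting) bij_is_inj inj_image_mem_iff map_prod_simp prod.inj_map)
qed


section \<open>The algebras attached to a base point\<close>

text \<open>At entry \<open>(g x, y)\<close> the left product is \<open>M $ x $ y\<close> and the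
  right one \<open>M $ g x $ g y\<close>; surjectivity of \<open>g\<close> reaches all
  entries.\<close>

lemma perm_mat_commute_iff:
  assumes "bij g"
  shows "perm_mat g ** M = M ** perm_mat g \<longleftrightarrow> (\<forall>x y. M $ g x $ g y = M $ x $ y)"
proof -
  have "(perm_mat g ** M) $ g x $ y = M $ x $ y" for x y
  proof -
    have "(perm_mat g ** M) $ g x $ y = (\<Sum>k\<in>UNIV. if x = k then M $ k $ y else 0)"
      using assms by (simp add: matrix_matrix_mult_def perm_mat_def bij_is_inj inj_eq
          mult_delta_left)
    then show ?thesis
      by simp
  qed
  moreover have "(M ** perm_mat g) $ x $ y = M $ x $ g y" for x y
    by (simp add: matrix_matrix_mult_def perm_mat_def mult_delta_right)
  ultimately show ?thesis
    using assms by (metis bij_pointE vec_eq_iff)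
qed

lemma centralizer_algebra_eq:
  "centralizer_algebra \<R> v =
     {M. \<forall>g\<in>point_stabilizer (scheme_Aut \<R>) v. \<forall>x y. M $ g x $ g y = M $ x $ y}"
proof -
  have "bij g" if "g \<in> point_stabilizer (scheme_Aut \<R>) v" for g
    using that by (simp add: point_stabilizer_eq scheme_Aut_def carrier_BijGroup_UNIV)
  then show ?thesis
    unfolding centralizer_algebra_def by (simp add: perm_mat_commute_iff cong: ball_cong)
qed

section \<open>Inclusions between the three spaces\<close>

lemma subalgebra_centralizer_algebra: "subalgebra (centralizer_algebra \<R> v)"
proof -
  have "mat 1 ** perm_mat g = perm_mat g ** mat 1" for g :: "'a \<Rightarrow> 'a"
    by simp
  then have "mat 1 \<in> centralizer_algebra \<R> v"
    by (simp add: centralizer_algebra_def)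
  moreover have "M ** N \<in> centralizer_algebra \<R> v"
    if "M \<in> centralizer_algebra \<R> v" "N \<in> centralizer_algebra \<R> v" for M N
    unfolding centralizer_algebra_def
  proof (rule CollectI, rule ballI)
    fix g
    assume "g \<in> point_stabilizer (scheme_Aut \<R>) v"
    then have "perm_mat g ** M = M ** perm_mat g" "perm_mat g ** N = N ** perm_mat g"
      using that by (auto simp: centralizer_algebra_def)
    then show "perm_mat g ** (M ** N) = M ** N ** perm_mat g"
      by (metis matrix_mul_assoc)
  qed
  moreover have "cmat.subspace (centralizer_algebra \<R> v)"
    by (auto simp: cmat.subspace_def centralizer_algebra_eq cmat_scale_def)
  ultimately show ?thesis
    by (simp add: subalgebra_def)
qed

lemma subalgebra_terwilliger_algebra: "subalgebra (terwilliger_algebra \<R> v)"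
  unfolding terwilliger_algebra_def
proof (rule hull_in)
  show "subalgebra (\<Inter>\<S>)" if "Ball \<S> subalgebra" for \<S> :: "'a cmat set set"
    using that cmat.subspace_Inter unfolding subalgebra_def by blast
qed

lemma T0_space_subset: "T0_space \<R> v \<subseteq> terwilliger_algebra \<R> v"
proof -
  have "adjacency R \<in> terwilliger_algebra \<R> v" "dual_idempotent v R \<in> terwilliger_algebra \<R> v"
    if "R \<in> \<R>" for R
    using that by (auto simp: terwilliger_algebra_def intro: hull_inc)
  with subalgebra_terwilliger_algebra[of \<R> v] show ?thesis
    unfolding T0_space_def by (intro cmat.span_minimal) (auto simp: subalgebra_def)
qed

text \<open>An automorphism fixing \<open>v\<close> preserves each set of points \<open>x\<close>
  with \<open>(v, x)\<close> in \<open>R\<close>, so its permutation matrix commutes with all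
  generators.\<close>

lemma terwilliger_algebra_subset: "terwilliger_algebra \<R> v \<subseteq> centralizer_algebra \<R> v"
  unfolding terwilliger_algebra_def
proof (rule hull_minimal)
  have inj: "g x = g y \<longleftrightarrow> x = y" if "g \<in> scheme_Aut \<R>" for g x y
    using that by (auto simp: scheme_Aut_def carrier_BijGroup_UNIV dest: bij_is_inj injD)
  have "(v, g x) \<in> R \<longleftrightarrow> (v, x) \<in> R" if "g \<in> scheme_Aut \<R>" "g v = v" "R \<in> \<R>" for g x R
    using scheme_Aut_mem_iff[of g \<R> R v x] that by simp
  then show "adjacency ` \<R> \<union> dual_idempotent v ` \<R> \<subseteq> centralizer_algebra \<R> v"
    by (auto simp: centralizer_algebra_eq point_stabilizer_eq adjacency_def dual_idempotent_def
        scheme_Aut_mem_iff inj)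
qed (rule subalgebra_centralizer_algebra)

lemma triple_product_nth:
  "(dual_idempotent v R ** adjacency S ** dual_idempotent v T) $ x $ y =
     (if (v, x) \<in> R \<and> (x, y) \<in> S \<and> (v, y) \<in> T then 1 else 0)"
proof -
  have "(dual_idempotent v R ** M) $ x $ y = (if (v, x) \<in> R then M $ x $ y else 0)"
    for M :: "'a cmat" and x y
    by (cases "(v, x) \<in> R")
      (simp_all add: matrix_matrix_mult_def dual_idempotent_def mult_delta_left)
  moreover have "(M ** dual_idempotent v T) $ x $ y = (if (v, y) \<in> T then M $ x $ y else 0)"
    for M :: "'a cmat" and x y
  proof -
    have "(M ** dual_idempotent v T) $ x $ y =
        (\<Sum>k\<in>UNIV. if k = y then if (v, y) \<in> T then M $ x $ k else 0 else 0)"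
      unfolding matrix_matrix_mult_def dual_idempotent_def vec_lambda_beta
      by (rule sum.cong) auto
    then show ?thesis
      by simp
  qed
  ultimately show ?thesis
    by (simp add: adjacency_def)
qed

text \<open>The triple products formed from orbitals are 0/1 matrices whose supports are disjoint
  and cover all pairs; \<open>const\<close> makes \<open>M\<close> constant on each support, hence a
  combination of them.\<close>

lemma mem_T0_space_orbitals:
  fixes M :: "'v::finite cmat"
  assumes "permutation_group G"
    and const: "\<And>R S T x y x' y'.
    \<lbrakk>R \<in> orbitals G; S \<in> orbitals G; T \<in> orbitals G;
     (v, x) \<in> R; (v, x') \<in> R; (x, y) \<in> S; (x', y') \<in> S; (v, y) \<in> T; (v, y') \<in> T\<rbrakk>
     \<Longrightarrow> M $ x $ y = M $ x' $ y'"
  shows "M \<in> T0_space (orbitals G) v"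
proof -
  interpret permutation_group G
    by fact
  define P where "P = orbitals G \<times> orbitals G \<times> orbitals G"
  define B where
    "B = (\<lambda>(R, S, T). dual_idempotent v R ** adjacency S ** dual_idempotent v T :: 'v cmat)"
  \<comment> \<open>The coefficient is the common value of \<open>M\<close> on the support; for an
    empty support the choice is arbitrary, but the product is then zero.\<close>
  define c where
    "c = (\<lambda>(R, S, T). SOME a. \<exists>x y. (v, x) \<in> R \<and> (x, y) \<in> S \<and> (v, y) \<in> T \<and> a = M $ x $ y)"
  have "M = (\<Sum>p\<in>P. cmat_scale (c p) (B p))"
  proof (unfold vec_eq_iff, intro allI)
    fix x y
    obtain R S T where RST: "R \<in> orbitals G" "S \<in> orbitals G" "T \<in> orbitals G"
      "(v, x) \<in> R" "(x, y) \<in> S" "(v, y) \<in> T"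
      by (metis orbital_exists)
    have "\<exists>x' y'. (v, x') \<in> R \<and> (x', y') \<in> S \<and> (v, y') \<in> T \<and> c (R, S, T) = M $ x' $ y'"
      unfolding c_def prod.case by (rule someI_ex) (use RST in blast)
    then have c: "c (R, S, T) = M $ x $ y"
      using const[OF RST(1-4) _ RST(5) _ RST(6)] by auto
    have B: "B p $ x $ y = (if p = (R, S, T) then 1 else 0)" if P: "p \<in> P" for p
    proof -
      obtain R' S' T' where p: "p = (R', S', T')"
        "R' \<in> orbitals G" "S' \<in> orbitals G" "T' \<in> orbitals G"
        using P by (auto simp: P_def)
      have "(v, x) \<in> R' \<longleftrightarrow> R' = R" "(x, y) \<in> S' \<longleftrightarrow> S' = S" "(v, y) \<in> T' \<longleftrightarrow> T' = T"
        using p RST orbital_unique[of R' R v x] orbital_unique[of S' S x y]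
          orbital_unique[of T' T v y]
        by metis+
      then show ?thesis
        by (simp add: p(1) B_def triple_product_nth)
    qed
    have "(\<Sum>p\<in>P. cmat_scale (c p) (B p)) $ x $ y =
        (\<Sum>p\<in>P. if p = (R, S, T) then c p else 0)"
      by (simp add: cmat_scale_def B mult_delta_right cong: sum.cong)
    also have "\<dots> = M $ x $ y"
      using RST c by (simp add: P_def)
    finally show "M $ x $ y = (\<Sum>p\<in>P. cmat_scale (c p) (B p)) $ x $ y" ..
  qed
  moreover have "B p \<in> T0_space (orbitals G) v" if "p \<in> P" for p
    using that unfolding T0_space_def B_def P_def by (intro cmat.span_base) auto
  ultimately show ?thesis
    unfolding T0_space_def by (simp only:) (intro cmat.span_sum cmat.span_scale)
qed

text \<open>\<open>lift\<close> is the orbit criterion in terms of group elements: \<open>a\<close>,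
  \<open>b\<close> and \<open>k\<close> witness that \<open>(v, x)\<close>, \<open>(v, y)\<close>
  and \<open>(x, y)\<close> stay in their orbitals when \<open>x\<close>, \<open>y\<close> become
  \<open>a x\<close>, \<open>b y\<close>; a single \<open>g\<close> fixing \<open>v\<close> must
  make both moves.\<close>

lemma triply_transitive_orbitalsI:
  fixes G :: "('v::finite \<Rightarrow> 'v) set"
  assumes G: "transitive_perm_group G"
    and lift: "\<And>v a b k x y. \<lbrakk>a \<in> point_stabilizer G v; b \<in> point_stabilizer G v; k \<in> G;
      k x = a x; k y = b y\<rbrakk> \<Longrightarrow> \<exists>g\<in>point_stabilizer G v. g x = a x \<and> g y = b y"
  shows "triply_transitive (orbitals G)"
proof -
  interpret permutation_group G
    using G by (simp add: permutation_group_def transitive_perm_group_iff)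
  have "transitive_perm_group (scheme_Aut (orbitals G))"
    using G subset_scheme_Aut subgroup_scheme_Aut[of "orbitals G"]
    unfolding transitive_perm_group_iff by (meson subsetD)
  moreover have "centralizer_algebra (orbitals G) v \<subseteq> T0_space (orbitals G) v" for v
  proof
    fix M :: "'v cmat"
    assume "M \<in> centralizer_algebra (orbitals G) v"
    \<comment> \<open>Pass from the stabilizer in \<open>scheme_Aut\<close> to its subgroup in
      \<open>G\<close>.\<close>
    then have M: "M $ g x $ g y = M $ x $ y" if "g \<in> point_stabilizer G v" for g x y
      using that subset_scheme_Aut by (auto simp: centralizer_algebra_eq point_stabilizer_eq)
    show "M \<in> T0_space (orbitals G) v"
    proof (rule mem_T0_space_orbitals[OF permutation_group_axioms])
      fix R S T x y x' y'
      assume R: "R \<in> orbitals G" "(v, x) \<in> R" "(v, x') \<in> R"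
        and S: "S \<in> orbitals G" "(x, y) \<in> S" "(x', y') \<in> S"
        and T: "T \<in> orbitals G" "(v, y) \<in> T" "(v, y') \<in> T"
      obtain a where a: "a \<in> point_stabilizer G v" "a x = x'"
        using orbital_transitive[OF R] by (auto simp: point_stabilizer_eq)
      obtain b where b: "b \<in> point_stabilizer G v" "b y = y'"
        using orbital_transitive[OF T] by (auto simp: point_stabilizer_eq)
      obtain k where "k \<in> G" "k x = x'" "k y = y'"
        using orbital_transitive[OF S] .
      then obtain g where "g \<in> point_stabilizer G v" "g x = x'" "g y = y'"
        using lift[of a v b k x y] a b by auto
      then show "M $ x $ y = M $ x' $ y'"
        using M by metis
    qed
  qed
  ultimately show ?thesis
    unfolding triply_transitive_def
    using T0_space_subset terwilliger_algebra_subset by blast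
qed


section \<open>Point stabilizers of order two\<close>

lemma regular_subgroup_lift:
  fixes G R :: "('v::finite \<Rightarrow> 'v) set"
  assumes G: "transitive_perm_group G"
    and card2: "\<And>v. card (point_stabilizer G v) = 2"
    and "R \<subseteq> G" and R: "regular_perm_group R"
    and a: "a \<in> point_stabilizer G v" and b: "b \<in> point_stabilizer G v"
    and k: "k \<in> G" "k x = a x" "k y = b y"
  shows "\<exists>g\<in>point_stabilizer G v. g x = a x \<and> g y = b y"
proof -
  interpret G: permutation_group G
    using G by (simp add: permutation_group_def transitive_perm_group_iff)
  interpret R: permutation_group R
    using R by (simp add: permutation_group_def regular_perm_group_def transitive_perm_group_iff)
  have R_trans: "\<exists>r\<in>R. r u = w" for u w
    using R by (simp add: regular_perm_group_def transitive_perm_group_iff)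
  have R_free: "r = id" if "r \<in> R" "r u = u" for r u
  proof -
    have "r \<in> point_stabilizer R u"
      using that by (simp add: point_stabilizer_eq)
    then show ?thesis
      using R by (auto simp: regular_perm_group_def perm_group_def one_BijGroup_UNIV)
  qed
  have stabilizer: "\<exists>s\<in>G. s u = u \<and> s \<noteq> id \<and> point_stabilizer G u = {id, s}" for u
  proof -
    have "id \<in> point_stabilizer G u"
      using G.id_mem by (simp add: point_stabilizer_eq)
    then obtain s where "s \<noteq> id" "point_stabilizer G u = {id, s}"
      using card2[of u] unfolding card_2_iff by (metis empty_iff insert_commute insert_iff)
    then show ?thesis
      by (auto simp: point_stabilizer_eq)
  qed
  obtain t where t: "t \<in> G" "t v = v" "t \<noteq> id" "point_stabilizer G v = {id, t}"
    using stabilizer by blast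
  \<comment> \<open>Either alternative gives an element of \<open>{id, t}\<close> acting as
    \<open>h\<close> does on \<open>x\<close> and \<open>y\<close>: \<open>t\<close> if it fixes
    \<open>x\<close>, \<open>id\<close> if \<open>t\<close> fixes \<open>y\<close>.\<close>
  have *: "t x = x \<or> t y = y" if h: "h \<in> G" "h x = x" "h y = t y" for h
  proof (cases "h = id")
    case False
    \<comment> \<open>Matching \<open>t\<close> at \<open>x\<close> puts \<open>t\<close> in the
      coset of \<open>r\<close> by the stabilizer \<open>{id, h}\<close> of \<open>x\<close>, so
      \<open>t\<close> is \<open>r\<close> or \<open>r \<circ> h\<close>.\<close>
    obtain r where r: "r \<in> R" "r x = t x"
      using R_trans by blast
    then have "Hilbert_Choice.inv r \<circ> t \<in> point_stabilizer G x"
      using t G.comp_mem G.inv_mem \<open>R \<subseteq> G\<close> R.inv_apply[OF r(1), of x]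
      by (auto simp: point_stabilizer_eq)
    moreover have "h \<in> point_stabilizer G x"
      using h by (simp add: point_stabilizer_eq)
    ultimately have "Hilbert_Choice.inv r \<circ> t = id \<or> Hilbert_Choice.inv r \<circ> t = h"
      using stabilizer[of x] False by auto
    moreover have "t = r \<circ> (Hilbert_Choice.inv r \<circ> t)"
      using R.apply_inv[OF r(1)] by (auto simp: fun_eq_iff)
    ultimately have "t = r \<or> t = r \<circ> h"
      by (metis comp_id)
    \<comment> \<open>Otherwise \<open>r\<close> would fix \<open>v\<close> and be trivial, contrary
      to \<open>t \<noteq> id\<close>.\<close>
    moreover have "t \<noteq> r"
      using R_free[of r v] r t by auto
    ultimately have "t = r \<circ> h"
      by blast
    \<comment> \<open>Evaluate at \<open>y\<close>, where \<open>h\<close> and \<open>t\<close>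
      agree.\<close>
    then have "r (t y) = t y"
      using h by simp
    then have "r = id"
      using R_free r by blast
    then show ?thesis
      using \<open>t = r \<circ> h\<close> h by simp
  qed (use that in auto)
  consider "a = b" | "a = id" "b = t" | "a = t" "b = id"
    using a b t by auto
  then show ?thesis
  proof cases
    case 1
    then show ?thesis
      using a by blast
  next
    case 2
    then show ?thesis
      using *[of k] k t by auto
  next
    case 3
    \<comment> \<open>Since \<open>t\<close> is an involution, \<open>t \<circ> k\<close> fixes
      \<open>x\<close> and sends \<open>y\<close> to \<open>t y\<close>, which reduces this case to
      the previous one.\<close>
    have "t \<circ> t = id"
    proof -
      have "t \<circ> t \<in> point_stabilizer G v"
        using t(1,2) G.comp_mem by (simp add: point_stabilizer_eq)
      moreover have "t \<circ> t \<noteq> t"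
        using t G.inv_apply[OF t(1)] by (metis comp_apply ext id_apply)
      ultimately show ?thesis
        using t by auto
    qed
    then have "(t \<circ> k) x = x" "(t \<circ> k) y = t y"
      using 3 k by (simp_all add: pointfree_idE)
    then have "t x = x \<or> t y = y"
      using *[of "t \<circ> k"] t k G.comp_mem by blast
    then show ?thesis
      using 3 t by auto
  qed
qed

theorem theorem1p3:
  fixes G R :: "('v::finite \<Rightarrow> 'v) set"
  assumes "transitive_perm_group G"
    and "\<And>v. card (point_stabilizer G v) = 2"
    and "subgroup R (BijGroup UNIV)" and "R \<subseteq> G"
    and "regular_perm_group R"
  shows "association_scheme (orbitals G) \<and> triply_transitive (orbitals G)"
proof
  show "association_scheme (orbitals G)"
    using assms(1) by (rule association_scheme_orbitals)
  show "triply_transitive (orbitals G)"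
    by (rule triply_transitive_orbitalsI, fact, rule regular_subgroup_lift[OF assms(1,2,4,5)])
qed

end
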